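(* Let $1\le m<n$ be integers, and let $N,a,b,r$ be constants with $2N+n>2$, $a,b>0$, $r\ge 0$. Let $\mathbf{X}\sim GL_n(\bm\mu,\mathbf\Sigma,g_n)$ with $$g_n(t)=\frac{t^{N-1}\exp(-at)}{(1+\exp(-bt))^{2r}},\quad t>0.$$ Partition $$\mathbf{X}=\begin{pmatrix}\mathbf{X}^{(1)}\\ \mathbf{X}^{(2)}\end{pmatrix},\quad \bm\mu=\begin{pmatrix}\bm\mu^{(1)}\\ \bm\mu^{(2)}\end{pmatrix},\quad \mathbf\Sigma=\begin{pmatrix}\mathbf\Sigma_{11}&\mathbf\Sigma_{12}\\ \mathbf\Sigma_{21}&\mathbf\Sigma_{22}\end{pmatrix},$$ where $\mathbf{X}^{(1)},\bm\mu^{(1)}\in\mathbb{R}^m$, $\mathbf{X}^{(2)},\bm\mu^{(2)}\in\mathbb{R}^{n-m}$, $\mathbf\Sigma_{11}$ is $m\times m$ and $\mathbf\Sigma_{22}$ is $(n-m)\times(n-m)$. Then $$\mathbf{X}^{(1)}\sim Ell_m(\bm\mu^{(1)},\mathbf\Sigma_{11},\widehat g_m),\qquad \mathbf{X}^{(2)}\sim Ell_{n-m}(\bm\mu^{(2)},\mathbf\Sigma_{22},\widehat g_{n-m}),$$ where $$\widehat g_m(u)=\sum_{j=0}^{N-1}\frac{(N-1)_j}{j!}\,\frac{\Gamma(\frac{n-m}2+j)}{b^{\frac{n-m}2+j}}\,u^{N-1-j}e^{-au}\,\Phi_{2r}^*\Big(-e^{-bu},\frac{n-m}2+j,\frac ab\Big),$$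 and $\widehat g_{n-m}$ is given by the same formula with $m$ replaced by $n-m$.
   Context: Here $(x)_j=x(x-1)\cdots(x-j+1)$ is the falling factorial, with $(x)_0=1$. $\Phi_v^*$ is the generalized Hurwitz-Lerch zeta function, which for $v\ge 0$, $|z|\le 1$, $z\ne 1$, $\sigma>0$, $\alpha>0$ has the integral representation $$\Phi_v^*(z,\sigma,\alpha)=\frac1{\Gamma(\sigma)}\int_0^\infty\frac{t^{\sigma-1}e^{-\alpha t}}{(1-ze^{-t})^{v}}\,dt .$$ $\mathbf{Y}\sim Ell_p(\bm\nu,\mathbf{S},h)$ means that $\mathbf{Y}$ has density $C\,|\mathbf{S}|^{-1/2}h\big((\mathbf{y}-\bm\nu)^T\mathbf{S}^{-1}(\mathbf{y}-\bm\nu)\big)$ on $\mathbb{R}^p$, where $C$ is the normalizing constant; $h$ is called the density generator. $\mathbf{X}\sim GL_n(\bm\mu,\mathbf\Sigma,g_n)$ (generalized elliptical logistic distribution) means $\mathbf{X}\sim Ell_n(\bm\mu,\mathbf\Sigma,g_n)$ with $\bm\mu\in\mathbb{R}^n$, $\mathbf\Sigma$ an $n\times n$ positive definite matrix and $g_n$ of the form given.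
   Formalization: N is taken to be a positive integer: for non-integer N the sum up to N-1 is undefined, and for integers N ≤ 0 allowed by 2N+n>2 (e.g. N=0, n=3) the sum is empty, so the stated generator is 0 and the claim fails. *)

theory Defs
  imports "HOL-Probability.Probability"
begin

definition falling_factorial :: "real \<Rightarrow> nat \<Rightarrow> real" where
  "falling_factorial x j = (\<Prod>i<j. x - real i)"

text \<open>The generalized Hurwitz-Lerch zeta function \<open>\<Phi>\<^sup>*\<^sub>v(z, \<sigma>, \<alpha>)\<close> for real arguments with
  \<open>v \<ge> 0\<close>, \<open>-1 \<le> z < 1\<close>, \<open>\<sigma> > 0\<close>, \<open>\<alpha> > 0\<close>, through its integral representation. In this range
  \<open>1 - z * exp (- t)\<close> is positive for \<open>t > 0\<close>, as \<open>powr\<close> requires.\<close>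

definition hurwitz_lerch :: "real \<Rightarrow> real \<Rightarrow> real \<Rightarrow> real \<Rightarrow> real" where
  "hurwitz_lerch v z \<sigma> \<alpha> =
     1 / Gamma \<sigma> *
     (LBINT t:{0<..}. t powr (\<sigma> - 1) * exp (- \<alpha> * t) / (1 - z * exp (- t)) powr v)"

definition pos_def_matrix :: "real ^ 'p ^ 'p \<Rightarrow> bool" where
  "pos_def_matrix S \<longleftrightarrow> transpose S = S \<and> (\<forall>x. x \<noteq> 0 \<longrightarrow> 0 < x \<bullet> (S *v x))"

text \<open>\<open>Y \<sim> Ell\<^sub>p(\<nu>, S, h)\<close> for a random vector on \<open>M\<close>, with \<open>p = CARD('p)\<close>. On a probability
  space the total mass of the density is 1, so \<open>C\<close> is forced to be the normalizing constant.
  The generator is required to be nonnegative because \<open>ennreal\<close> truncates negative values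
  to 0.\<close>

definition Ell ::
  "'w measure \<Rightarrow> ('w \<Rightarrow> real ^ 'p) \<Rightarrow> real ^ 'p \<Rightarrow> real ^ 'p ^ 'p \<Rightarrow> (real \<Rightarrow> real) \<Rightarrow> bool" where
  "Ell M Y \<nu> S h \<longleftrightarrow>
     pos_def_matrix S \<and> (\<forall>t>0. 0 \<le> h t) \<and>
     (\<exists>C>0. distributed M lborel Y
        (\<lambda>y. ennreal (C * det S powr (- 1 / 2) * h ((y - \<nu>) \<bullet> (matrix_inv S *v (y - \<nu>))))))"

definition gl_generator :: "real \<Rightarrow> real \<Rightarrow> real \<Rightarrow> real \<Rightarrow> real \<Rightarrow> real" where
  "gl_generator N a b r t =
     t powr (N - 1) * exp (- a * t) / (1 + exp (- b * t)) powr (2 * r)"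

definition GL ::
  "'w measure \<Rightarrow> ('w \<Rightarrow> real ^ 'n) \<Rightarrow> real ^ 'n \<Rightarrow> real ^ 'n ^ 'n
     \<Rightarrow> real \<Rightarrow> real \<Rightarrow> real \<Rightarrow> real \<Rightarrow> bool" where
  "GL M X \<mu> \<Sigma> N a b r \<longleftrightarrow> Ell M X \<mu> \<Sigma> (gl_generator N a b r)"

text \<open>The generator of the \<open>m\<close>-dimensional marginal of an \<open>n\<close>-dimensional vector. It is the
  binomial expansion of \<open>(u + s) ^ (N - 1)\<close> integrated against the \<open>n - m\<close> remaining coordinates,
  so it is meant for integers \<open>N \<ge> 1\<close> only. At \<open>N = 0\<close>, truncated subtraction makes the sum range
  over \<open>{0}\<close>.\<close>

definition marginal_generator ::
  "nat \<Rightarrow> real \<Rightarrow> real \<Rightarrow> real \<Rightarrow> nat \<Rightarrow> nat \<Rightarrow> real \<Rightarrow> real" where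
  "marginal_generator N a b r n m u =
     (\<Sum>j = 0..N - 1.
        falling_factorial (real N - 1) j / fact j *
        (Gamma (real (n - m) / 2 + real j) / b powr (real (n - m) / 2 + real j)) *
        u ^ (N - 1 - j) * exp (- a * u) *
        hurwitz_lerch (2 * r) (- exp (- b * u)) (real (n - m) / 2 + real j) (a / b))"

text \<open>A vector of \<open>\<real>\<^sup>n\<close> split into its first \<open>m\<close> and last \<open>n - m\<close> coordinates is indexed by
  \<open>'m + 'k\<close> with \<open>CARD('m) = m\<close> and \<open>CARD('k) = n - m\<close>.\<close>

definition vec_block1 :: "'a ^ ('m::finite + 'k::finite) \<Rightarrow> 'a ^ 'm" where
  "vec_block1 x = (\<chi> i. x $ Inl i)"

definition vec_block2 :: "'a ^ ('m::finite + 'k::finite) \<Rightarrow> 'a ^ 'k" where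
  "vec_block2 x = (\<chi> i. x $ Inr i)"

definition mat_block11 :: "'a ^ ('m::finite + 'k::finite) ^ ('m + 'k) \<Rightarrow> 'a ^ 'm ^ 'm" where
  "mat_block11 A = (\<chi> i j. A $ Inl i $ Inl j)"

definition mat_block22 :: "'a ^ ('m::finite + 'k::finite) ^ ('m + 'k) \<Rightarrow> 'a ^ 'k ^ 'k" where
  "mat_block22 A = (\<chi> i j. A $ Inr i $ Inr j)"

end

theory Submission
  imports Defs
begin

text \<open>The marginal density at \<open>x\<close> is the integral of the joint density over the remaining \<open>d\<close>
  coordinates \<open>y\<close>. Completing the square in \<open>y\<close> (lemma \<open>inverse_form_complete_square\<close>) splits the
  quadratic form of the inverse of \<open>\<Sigma>\<close> into the quadratic form \<open>u\<close> of \<open>x\<close> for the inverse of the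
  diagonal block, plus \<open>q (y - s x)\<close> for a positive definite \<open>q\<close> that does not depend on \<open>x\<close>.
  Translation removes the shift. Under \<open>q\<close>, Lebesgue measure is mapped to a multiple of
  \<open>s powr (d / 2 - 1) ds\<close> on the positive half-line (lemma \<open>nn_integral_degree_two_homogeneous\<close>), so
  the marginal is elliptical with generator \<open>\<integral> s powr (d / 2 - 1) * g (u + s) ds\<close>, up to a constant
  (theorem \<open>Ell_marginal\<close>).

  For the logistic generator \<open>g\<close>, expanding \<open>(u + s) ^ (N - 1)\<close> by the binomial theorem leaves
  integrals of \<open>s powr (d / 2 + j - 1) * exp (- a * s)\<close> over a power of \<open>1 + exp (- b * (u + s))\<close>.
  Substituting \<open>t = b * s\<close> identifies them with values of the Hurwitz-Lerch function
  (lemma \<open>nn_integral_gl_generator\<close>).\<close>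

section \<open>The image of Lebesgue measure under a homogeneous function of degree two\<close>

text \<open>This replaces polar coordinates. Homogeneity gives the sublevel set \<open>{q \<le> t}\<close> the volume
  \<open>v * t powr (d / 2)\<close> with \<open>v\<close> the volume of \<open>{q \<le> 1}\<close>, and the half-lines \<open>{..t}\<close> determine the
  image of Lebesgue measure under \<open>q\<close>; differentiating in \<open>t\<close> yields the density. For a quadratic
  form the constant would be \<open>pi powr (d / 2) / Gamma (d / 2)\<close> over the root of the determinant, but
  a normalizing constant absorbs it, so positivity is all that is recorded.\<close>

lemma nn_integral_degree_two_homogeneous:
  fixes q :: "'a::euclidean_space \<Rightarrow> real"
  assumes cont: "continuous_on UNIV q"
    and hom: "\<And>c z. q (c *\<^sub>R z) = c\<^sup>2 * q z"
    and pos: "\<And>z. z \<noteq> 0 \<Longrightarrow> 0 < q z"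
  obtains c where "c > 0"
    and "\<And>h :: real \<Rightarrow> ennreal. h \<in> borel_measurable borel \<Longrightarrow>
      (\<integral>\<^sup>+z. h (q z) \<partial>lborel) =
      ennreal c * (\<integral>\<^sup>+s\<in>{0<..}. ennreal (s powr (real DIM('a) / 2 - 1)) * h s \<partial>lborel)"
proof -
  define d where "d = real DIM('a)"
  have d: "d > 0" by (simp add: d_def)
  have q0: "q 0 = 0" using hom[of 0 0] by simp
  have meas_q [measurable]: "q \<in> borel_measurable borel"
    by (rule borel_measurable_continuous_onI) (rule cont)
  define B where "B t = {z. q z \<le> t}" for t
  have B_meas [measurable]: "B t \<in> sets borel" for t unfolding B_def by measurable
  \<comment> \<open>On the unit sphere \<open>q\<close> has a positive minimum, so its sublevel sets are bounded.\<close>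
  obtain e where e: "e > 0" "\<And>z. e * (norm z)\<^sup>2 \<le> q z"
  proof -
    have "sphere (0::'a) 1 \<noteq> {}" using vector_choose_size[of 1, where 'a='a] by (auto simp: sphere_def)
    then obtain x where x: "x \<in> sphere 0 1" "\<forall>y\<in>sphere (0::'a) 1. q x \<le> q y"
      using continuous_attains_inf[of "sphere 0 1" q] continuous_on_subset[OF cont] by auto
    have "q x * (norm z)\<^sup>2 \<le> q z" for z
    proof (cases "z = 0")
      case False
      then have "q x \<le> q (inverse (norm z) *\<^sub>R z)" using x by simp
      also have "\<dots> = q z / (norm z)\<^sup>2" by (simp add: hom field_simps)
      finally show ?thesis using False by (simp add: field_simps)
    qed (simp add: q0)
    moreover have "x \<noteq> 0" using x by auto
    then have "q x > 0" by (rule pos)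
    ultimately show ?thesis using that by blast
  qed
  define v where "v = measure lborel (B 1)"
  have fin: "emeasure lborel (B 1) < \<infinity>"
  proof -
    have "norm z \<le> 1 / sqrt e" if "z \<in> B 1" for z
    proof -
      have "e * (norm z)\<^sup>2 \<le> 1" using e(2)[of z] that by (simp add: B_def)
      then have "(norm z)\<^sup>2 \<le> (1 / sqrt e)\<^sup>2" using e(1) by (simp add: field_simps)
      then show ?thesis using e(1) by (simp add: power2_le_iff_abs_le)
    qed
    then have "bounded (B 1)" unfolding bounded_iff by blast
    then show ?thesis by (rule emeasure_bounded_finite)
  qed
  then have V: "emeasure lborel (B 1) = ennreal v" unfolding v_def
    by (intro emeasure_eq_ennreal_measure) auto
  have v_pos: "v > 0"
  proof -
    have "open {z. q z < 1}" using cont by (intro open_Collect_less) auto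
    moreover have "0 \<in> {z. q z < 1}" by (simp add: q0)
    ultimately have "\<not> negligible {z. q z < 1}" using open_not_negligible by blast
    then have "emeasure lborel {z. q z < 1} \<noteq> 0"
      by (auto simp: negligible_iff_null_sets null_sets_def) 
    moreover have "emeasure lborel {z. q z < 1} \<le> emeasure lborel (B 1)"
      by (intro emeasure_mono) (auto simp: B_def)
    ultimately have "ennreal v \<noteq> 0" unfolding V by auto
    then show ?thesis by (simp add: ennreal_eq_0_iff)
  qed
  have scaled: "emeasure lborel (B t) = ennreal (v * t powr (d / 2))" if t: "t > 0" for t
  proof -
    have "emeasure lborel (B t) =
      emeasure (density (distr lborel borel (\<lambda>x. 0 + sqrt t *\<^sub>R x)) (\<lambda>_. \<bar>sqrt t\<bar>^DIM('a))) (B t)"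
      using lborel_affine[of "sqrt t" "0::'a"] t by simp
    also have "\<dots> = ennreal (\<bar>sqrt t\<bar>^DIM('a)) * emeasure lborel ((\<lambda>x. sqrt t *\<^sub>R x) -` B t)"
      by (subst emeasure_density, simp_all)
        (subst nn_integral_cmult, simp_all add: emeasure_distr space_borel)
    also have "(\<lambda>x. sqrt t *\<^sub>R x) -` B t = B 1"
      using t by (auto simp: B_def hom)
    also have "ennreal (\<bar>sqrt t\<bar>^DIM('a)) * emeasure lborel (B 1) = ennreal (v * t powr (d / 2))"
      unfolding V using t v_pos
      by (subst ennreal_mult'[symmetric])
        (simp_all add: d_def powr_realpow[symmetric] powr_half_sqrt[symmetric] powr_powr mult.commute)
    finally show ?thesis .
  qed
  define c where "c = v * d / 2"
  have c: "c > 0" using v_pos d by (simp add: c_def)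
  define D where "D = density lborel (\<lambda>s. ennreal (c * s powr (d / 2 - 1)) * indicator {0<..} s)"
  have D_pos: "emeasure D {..t} = ennreal (v * t powr (d / 2))" if t: "t > 0" for t
  proof -
    have "emeasure D {..t} = (\<integral>\<^sup>+s. ennreal (c * s powr (d / 2 - 1)) * indicator {0..t} s \<partial>lborel)"
      unfolding D_def by (subst emeasure_density) (auto intro!: nn_integral_cong split: split_indicator)
    also have "\<dots> = ennreal (c * (t powr (d / 2 - 1 + 1) / (d / 2 - 1 + 1)))"
      using c d t by (intro nn_integral_has_integral_lebesgue' has_integral_mult_right
        has_integral_powr_from_0) auto
    also have "c * (t powr (d / 2 - 1 + 1) / (d / 2 - 1 + 1)) = v * t powr (d / 2)"
      using d by (simp add: c_def)
    finally show ?thesis .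
  qed
  have D_neg: "emeasure D {..t} = 0" if t: "t \<le> 0" for t
  proof -
    have "emeasure D {..t} = (\<integral>\<^sup>+s. ennreal (c * s powr (d / 2 - 1)) * indicator {0<..} s * indicator {..t} s \<partial>lborel)"
      unfolding D_def by (subst emeasure_density) auto
    also have "\<dots> = (\<integral>\<^sup>+s. 0 \<partial>(lborel :: real measure))"
      using t by (intro nn_integral_cong) (auto split: split_indicator)
    finally show ?thesis by simp
  qed
  have push: "emeasure (distr lborel borel q) {..t} = emeasure lborel (B t)" for t
    by (subst emeasure_distr) (auto simp: B_def vimage_def)
  \<comment> \<open>Both measures are finite on half-lines and give them the same mass.\<close>
  have "distr lborel borel q = D"
  proof (rule measure_eqI_generator_eq[where E = "range atMost" and \<Omega> = UNIV and A = "\<lambda>n. {..real n}"])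
    show "Int_stable (range (atMost :: real \<Rightarrow> real set))"
      by (auto simp: Int_stable_def)
    show "emeasure (distr lborel borel q) X = emeasure D X" if "X \<in> range atMost" for X
    proof -
      from that obtain t where X: "X = {..t}" by (rule imageE)
      show ?thesis
      proof (cases "t > 0")
        case True then show ?thesis unfolding X push by (simp add: scaled D_pos)
      next
        case False
        \<comment> \<open>At \<open>t = 0\<close> the sublevel set is the origin, a null set, not the empty set.\<close>
        then have "B t \<subseteq> {0}" using pos by (force simp: B_def)
        then have "emeasure lborel (B t) \<le> emeasure lborel {0::'a}" by (intro emeasure_mono) auto
        then show ?thesis using False unfolding X push by (simp add: D_neg)
      qed
    qed
    show "(\<Union>i. {..real i}) = UNIV" by (auto intro: real_arch_simple)
    show "emeasure (distr lborel borel q) {..real i} \<noteq> \<infinity>" for i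
    proof -
      have "emeasure lborel (B (real i)) \<le> emeasure lborel (B (real i + 1))"
        by (intro emeasure_mono) (auto simp: B_def)
      also have "\<dots> < \<infinity>" by (simp add: scaled)
      finally show ?thesis unfolding push by simp
    qed
  qed (auto simp: D_def borel_eq_atMost)
  note push_eq = this
  have "(\<integral>\<^sup>+z. h (q z) \<partial>lborel) =
      ennreal c * (\<integral>\<^sup>+s\<in>{0<..}. ennreal (s powr (real DIM('a) / 2 - 1)) * h s \<partial>lborel)"
    if [measurable]: "h \<in> borel_measurable borel" for h :: "real \<Rightarrow> ennreal"
  proof -
    have "(\<integral>\<^sup>+z. h (q z) \<partial>lborel) = (\<integral>\<^sup>+s. h s \<partial>distr lborel borel q)"
      by (subst nn_integral_distr) auto
    also have "\<dots> = (\<integral>\<^sup>+s. ennreal c * (ennreal (s powr (d / 2 - 1)) * h s * indicator {0<..} s) \<partial>lborel)"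
      unfolding push_eq D_def using c
      by (subst nn_integral_density) (auto intro!: nn_integral_cong simp: ennreal_mult' mult_ac)
    also have "\<dots> = ennreal c * (\<integral>\<^sup>+s\<in>{0<..}. ennreal (s powr (d / 2 - 1)) * h s \<partial>lborel)"
      by (subst nn_integral_cmult) auto
    finally show ?thesis by (simp add: d_def)
  qed
  with c show ?thesis using that by blast
qed

section \<open>Splitting the coordinates of a vector\<close>

text \<open>A bijection \<open>e\<close> from \<open>'p + 'q\<close> to the index type names the coordinates that are kept
  (\<open>Inl\<close>) and those that are integrated out (\<open>Inr\<close>). With \<open>e\<close> as a parameter, a single marginal
  theorem covers the first block (identity) and the second block (swap).\<close>

definition part1 :: "('p + 'q \<Rightarrow> 'n) \<Rightarrow> real ^ 'n \<Rightarrow> real ^ 'p" where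
  "part1 e v = (\<chi> i. v $ e (Inl i))"

definition part2 :: "('p + 'q \<Rightarrow> 'n) \<Rightarrow> real ^ 'n \<Rightarrow> real ^ 'q" where
  "part2 e v = (\<chi> i. v $ e (Inr i))"

definition submat1 :: "('p + 'q \<Rightarrow> 'n) \<Rightarrow> real ^ 'n ^ 'n \<Rightarrow> real ^ 'p ^ 'p" where
  "submat1 e A = (\<chi> i j. A $ e (Inl i) $ e (Inl j))"

definition glue :: "('p + 'q \<Rightarrow> 'n) \<Rightarrow> real ^ 'p \<Rightarrow> real ^ 'q \<Rightarrow> real ^ 'n" where
  "glue e x y = (\<chi> i. case inv e i of Inl a \<Rightarrow> x $ a | Inr a \<Rightarrow> y $ a)"

lemma glue_nth:
  assumes "bij e"
  shows "glue e x y $ e (Inl a) = x $ a" "glue e x y $ e (Inr b) = y $ b"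
  using assms by (simp_all add: glue_def bij_is_inj)

lemma part_glue:
  assumes "bij e"
  shows "part1 e (glue e x y) = x" "part2 e (glue e x y) = y"
  using assms by (simp_all add: part1_def part2_def glue_nth vec_eq_iff)

lemma part_zero: "part1 e 0 = 0" "part2 e 0 = 0"
  by (simp_all add: part1_def part2_def vec_eq_iff)

lemma all_index_split:
  assumes "bij e"
  shows "(\<forall>i. P i) \<longleftrightarrow> (\<forall>a. P (e (Inl a))) \<and> (\<forall>b. P (e (Inr b)))"
  using assms by (metis bij_pointE obj_sumE)

lemma glue_part:
  assumes "bij e"
  shows "glue e (part1 e v) (part2 e v) = v"
  by (simp add: vec_eq_iff all_index_split[OF assms] glue_nth[OF assms] part1_def part2_def)

lemma glue_add: "glue e (x + x') (y + y') = glue e x y + glue e x' y'"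
  by (simp add: glue_def vec_eq_iff split: sum.splits)

lemma glue_diff: "glue e (x - x') (y - y') = glue e x y - glue e x' y'"
  by (simp add: glue_def vec_eq_iff split: sum.splits)

lemma glue_scaleR: "glue e (c *\<^sub>R x) (c *\<^sub>R y) = c *\<^sub>R glue e x y"
  by (simp add: glue_def vec_eq_iff split: sum.splits)

lemma continuous_on_glue:
  "continuous_on UNIV (\<lambda>(x, y). glue e (x :: real ^ 'p) (y :: real ^ 'q))"
proof -
  have "continuous_on UNIV (\<lambda>p. case inv e i of Inl a \<Rightarrow> fst p $ a | Inr b \<Rightarrow> snd p $ b)" for i
    by (cases "inv e i") (auto intro!: continuous_intros)
  then show ?thesis
    unfolding glue_def case_prod_beta by (intro continuous_on_vec_lambda)
qed

lemma continuous_on_part1: "continuous_on UNIV (part1 e)"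
  unfolding part1_def by (intro continuous_intros)

lemma sum_index_split:
  fixes e :: "'p::finite + 'q::finite \<Rightarrow> 'n::finite"
  assumes "bij e"
  shows "sum f UNIV = (\<Sum>a\<in>UNIV. f (e (Inl a))) + (\<Sum>b\<in>UNIV. f (e (Inr b)))"
proof -
  have "sum f UNIV = (\<Sum>x\<in>UNIV. f (e x))" using sum.reindex_bij_betw[OF assms] by metis
  also have "\<dots> = (\<Sum>x\<in>UNIV <+> UNIV. f (e x))" by (simp add: UNIV_Plus_UNIV)
  finally show ?thesis by (simp add: sum.Plus o_def del: UNIV_Plus_UNIV)
qed

lemma prod_index_split:
  fixes e :: "'p::finite + 'q::finite \<Rightarrow> 'n::finite"
  assumes "bij e"
  shows "prod f UNIV = (\<Prod>a\<in>UNIV. f (e (Inl a))) * (\<Prod>b\<in>UNIV. f (e (Inr b)))"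
proof -
  have "prod f UNIV = (\<Prod>x\<in>UNIV. f (e x))" using prod.reindex_bij_betw[OF assms] by metis
  also have "\<dots> = (\<Prod>x\<in>UNIV <+> UNIV. f (e x))" by (simp add: UNIV_Plus_UNIV)
  finally show ?thesis by (simp add: prod.Plus o_def del: UNIV_Plus_UNIV)
qed

lemma inner_glue:
  fixes e :: "'p::finite + 'q::finite \<Rightarrow> 'n::finite"
  assumes "bij e"
  shows "glue e x y \<bullet> v = x \<bullet> part1 e v + y \<bullet> part2 e v"
  unfolding inner_vec_def sum_index_split[OF assms]
  by (simp add: glue_nth[OF assms] part1_def part2_def)

lemma part1_matrix_glue_0:
  fixes e :: "'p::finite + 'q::finite \<Rightarrow> 'n::finite"
  assumes "bij e"
  shows "part1 e (A *v glue e w 0) = submat1 e A *v w"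
  by (simp add: vec_eq_iff part1_def submat1_def matrix_vector_mult_def sum_index_split[OF assms]
      glue_nth[OF assms])

lemma prod_Basis_vec: "(\<Prod>b\<in>Basis. v \<bullet> b) = (\<Prod>i\<in>UNIV. v $ i)" for v :: "real ^ 'n"
proof -
  have B: "(Basis :: (real ^ 'n) set) = range (\<lambda>i. axis i 1)" by (auto simp: Basis_vec_def)
  have inj: "inj (\<lambda>i :: 'n. axis i (1::real))" by (simp add: inj_on_def axis_eq_axis)
  show ?thesis unfolding B prod.reindex[OF inj] by (simp add: inner_axis)
qed

text \<open>Lebesgue measure is determined by the volumes of boxes, and \<open>glue\<close> turns a product of two
  boxes into a box.\<close>

lemma distr_glue_lborel:
  fixes e :: "'p::finite + 'q::finite \<Rightarrow> 'n::finite"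
  assumes e: "bij e"
  shows "distr (lborel \<Otimes>\<^sub>M lborel) borel (\<lambda>(x, y). glue e x y) = lborel"
proof (rule lborel_eqI[symmetric])
  have m: "(\<lambda>(x, y). glue e x y) \<in> lborel \<Otimes>\<^sub>M lborel \<rightarrow>\<^sub>M borel"
    unfolding lborel_prod using borel_measurable_continuous_onI[OF continuous_on_glue] by simp
  fix l u :: "real ^ 'n" assume lu: "\<And>b. b \<in> Basis \<Longrightarrow> l \<bullet> b \<le> u \<bullet> b"
  have le: "l $ i \<le> u $ i" for i using lu[of "axis i 1"] by (simp add: inner_axis)
  have pre: "(\<lambda>(x, y). glue e x y) -` box l u \<inter> space (lborel \<Otimes>\<^sub>M lborel)
      = box (part1 e l) (part1 e u) \<times> box (part2 e l) (part2 e u)"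
    by (auto simp: mem_box_cart all_index_split[OF e, where P = "\<lambda>i. l $ i < _ i \<and> _ i < u $ i"]
        glue_nth[OF e] part1_def part2_def space_pair_measure)
  have *: "emeasure lborel (box x y) = ennreal (\<Prod>i\<in>UNIV. (y - x) $ i)"
    if "\<And>i. x $ i \<le> y $ i" for x y :: "real ^ 'a"
    using that unfolding prod_Basis_vec[symmetric]
    by (intro emeasure_lborel_box) (auto simp: Basis_vec_def inner_axis)
  have "emeasure (distr (lborel \<Otimes>\<^sub>M lborel) borel (\<lambda>(x, y). glue e x y)) (box l u) =
      emeasure (lborel \<Otimes>\<^sub>M lborel) (box (part1 e l) (part1 e u) \<times> box (part2 e l) (part2 e u))"
    by (subst emeasure_distr[OF m]) (auto simp: pre)
  also have "\<dots> = emeasure lborel (box (part1 e l) (part1 e u)) * emeasure lborel (box (part2 e l) (part2 e u))"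
    by (rule lborel.emeasure_pair_measure_Times) auto
  also have "\<dots> = ennreal (\<Prod>i\<in>UNIV. (u - l) $ i)"
    by (subst (1 2) *) (auto simp: le part1_def part2_def prod_index_split[OF e] prod_nonneg
        ennreal_mult[symmetric])
  finally show "emeasure (distr (lborel \<Otimes>\<^sub>M lborel) borel (\<lambda>(x, y). glue e x y)) (box l u) =
      ennreal (\<Prod>b\<in>Basis. (u - l) \<bullet> b)" by (simp add: prod_Basis_vec)
qed simp

lemma nn_integral_glue:
  fixes e :: "'p::finite + 'q::finite \<Rightarrow> 'n::finite"
  assumes e: "bij e" and [measurable]: "f \<in> borel_measurable borel"
  shows "(\<lambda>x. \<integral>\<^sup>+y. f (glue e x y) \<partial>lborel) \<in> borel_measurable borel"
    and "(\<integral>\<^sup>+v. f v \<partial>lborel) = (\<integral>\<^sup>+x. \<integral>\<^sup>+y. f (glue e x y) \<partial>lborel \<partial>lborel)"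
proof -
  have m: "(\<lambda>(x, y). glue e x y) \<in> lborel \<Otimes>\<^sub>M lborel \<rightarrow>\<^sub>M borel"
    unfolding lborel_prod using borel_measurable_continuous_onI[OF continuous_on_glue] by simp
  have fm: "(\<lambda>(x, y). f (glue e x y)) \<in> borel_measurable (lborel \<Otimes>\<^sub>M lborel)"
    using measurable_compose[OF m assms(2)] by (simp add: case_prod_beta)
  show "(\<lambda>x. \<integral>\<^sup>+y. f (glue e x y) \<partial>lborel) \<in> borel_measurable borel"
    using lborel.borel_measurable_nn_integral[OF fm] by simp
  have "(\<integral>\<^sup>+v. f v \<partial>lborel) = (\<integral>\<^sup>+p. f (case p of (x, y) \<Rightarrow> glue e x y) \<partial>(lborel \<Otimes>\<^sub>M lborel))"
    by (subst distr_glue_lborel[OF e, symmetric], rule nn_integral_distr[OF m]) simp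
  also have "\<dots> = (\<integral>\<^sup>+x. \<integral>\<^sup>+y. f (glue e x y) \<partial>lborel \<partial>lborel)"
    using lborel.nn_integral_fst[OF fm] by (simp add: case_prod_unfold)
  finally show "(\<integral>\<^sup>+v. f v \<partial>lborel) = (\<integral>\<^sup>+x. \<integral>\<^sup>+y. f (glue e x y) \<partial>lborel \<partial>lborel)" .
qed

section \<open>Marginals of elliptical distributions\<close>

lemma pos_def_invertible:
  assumes "pos_def_matrix S"
  shows "invertible S"
proof -
  have "x = 0" if "S *v x = 0" for x
    using assms that by (force simp: pos_def_matrix_def)
  then show ?thesis
    by (simp add: invertible_left_inverse matrix_left_invertible_ker)
qed

lemma matrix_inv_vector_cancel:
  fixes S :: "real ^ 'n ^ 'n"
  assumes "invertible S"
  shows "S *v (matrix_inv S *v x) = x" "matrix_inv S *v (S *v x) = x"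
proof -
  have "S ** matrix_inv S = mat 1 \<and> matrix_inv S ** S = mat 1"
    using assms unfolding invertible_def matrix_inv_def by (rule someI_ex)
  then show "S *v (matrix_inv S *v x) = x" "matrix_inv S *v (S *v x) = x"
    by (simp_all add: matrix_vector_mul_assoc)
qed

lemma pos_def_inverse_form:
  fixes S :: "real ^ 'n ^ 'n"
  assumes "pos_def_matrix S"
  shows "(matrix_inv S *v x) \<bullet> y = x \<bullet> (matrix_inv S *v y)"
    and "x \<noteq> 0 \<Longrightarrow> 0 < x \<bullet> (matrix_inv S *v x)"
proof -
  note inv = matrix_inv_vector_cancel[OF pos_def_invertible[OF assms]]
  have sym: "(S *v x) \<bullet> y = x \<bullet> (S *v y)" for x y
  proof -
    have "transpose S = S" using assms by (simp add: pos_def_matrix_def)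
    then have "S *v x = x v* S" using transpose_matrix_vector[of S x] by simp
    then show ?thesis by (simp add: dot_lmul_matrix)
  qed
  show "(matrix_inv S *v x) \<bullet> y = x \<bullet> (matrix_inv S *v y)"
    using sym[of "matrix_inv S *v x" "matrix_inv S *v y"] by (simp add: inv)
  assume "x \<noteq> 0"
  then have "matrix_inv S *v x \<noteq> 0" using inv(1)[of x] by auto
  then have "0 < (matrix_inv S *v x) \<bullet> (S *v (matrix_inv S *v x))"
    using assms by (simp add: pos_def_matrix_def)
  then show "0 < x \<bullet> (matrix_inv S *v x)" by (simp add: inv inner_commute)
qed

lemma pos_def_submat1:
  fixes e :: "'p::finite + 'q::finite \<Rightarrow> 'n::finite"
  assumes e: "bij e" and S: "pos_def_matrix S"
  shows "pos_def_matrix (submat1 e S)"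
  unfolding pos_def_matrix_def
proof (intro conjI allI impI)
  have "S $ i $ j = S $ j $ i" for i j
  proof -
    have "transpose S $ i $ j = S $ i $ j" using S by (simp add: pos_def_matrix_def)
    then show ?thesis by (simp add: transpose_def)
  qed
  then show "transpose (submat1 e S) = submat1 e S"
    by (simp add: vec_eq_iff submat1_def transpose_def)
  fix x :: "real ^ 'p" assume "x \<noteq> 0"
  then have "glue e x 0 \<noteq> 0"
    using part_glue(1)[OF e, of x 0] by (metis part_zero(1))
  then have "0 < glue e x 0 \<bullet> (S *v glue e x 0)" using S by (simp add: pos_def_matrix_def)
  then show "0 < x \<bullet> (submat1 e S *v x)"
    by (simp add: inner_glue[OF e] part1_matrix_glue_0[OF e])
qed

text \<open>Completing the square in \<open>y\<close> needs no Schur complement. Let \<open>B\<close> be the kept block of \<open>S\<close> and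
  \<open>w\<close> the vector with parts \<open>matrix_inv B *v x\<close> and 0. Then \<open>S *v w\<close> has first part \<open>x\<close>, so
  \<open>glue e x y = S *v w + d\<close> with \<open>d\<close> zero on the kept coordinates. Both cross terms equal \<open>d \<bullet> w\<close>,
  which is 0 because \<open>d\<close> and \<open>w\<close> have complementary supports, and the value at \<open>S *v w\<close> is
  \<open>(S *v w) \<bullet> w = x \<bullet> (matrix_inv B *v x)\<close>.\<close>

lemma inverse_form_complete_square:
  fixes e :: "'p::finite + 'q::finite \<Rightarrow> 'n::finite"
  assumes e: "bij e" and S: "pos_def_matrix S"
  defines "s \<equiv> \<lambda>x. part2 e (S *v glue e (matrix_inv (submat1 e S) *v x) 0)"
  shows "glue e x y \<bullet> (matrix_inv S *v glue e x y) =
    x \<bullet> (matrix_inv (submat1 e S) *v x) +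
    glue e 0 (y - s x) \<bullet> (matrix_inv S *v glue e 0 (y - s x))"
proof -
  define w where "w = glue e (matrix_inv (submat1 e S) *v x) 0"
  define d where "d = glue e 0 (y - s x)"
  note inv = matrix_inv_vector_cancel[OF pos_def_invertible[OF S]]
  have p1: "part1 e (S *v w) = x"
    by (simp add: w_def part1_matrix_glue_0[OF e]
        matrix_inv_vector_cancel[OF pos_def_invertible[OF pos_def_submat1[OF e S]]])
  then have Sw: "S *v w = glue e x (s x)"
    using glue_part[OF e, of "S *v w"] by (simp add: s_def w_def)
  have split: "glue e x y = S *v w + d"
    unfolding Sw d_def by (simp add: glue_add[symmetric])
  have dw: "d \<bullet> w = 0"
    by (simp add: d_def inner_glue[OF e]) (simp add: w_def part_glue[OF e])
  have "glue e x y \<bullet> (matrix_inv S *v glue e x y) =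
      (S *v w) \<bullet> w + (S *v w) \<bullet> (matrix_inv S *v d) + d \<bullet> w + d \<bullet> (matrix_inv S *v d)"
    unfolding split by (simp add: matrix_vector_right_distrib inner_add inv)
  also have "(S *v w) \<bullet> (matrix_inv S *v d) = 0"
    using pos_def_inverse_form(1)[OF S, of "S *v w" d] dw by (simp add: inv inner_commute)
  also have "(S *v w) \<bullet> w = x \<bullet> (matrix_inv (submat1 e S) *v x)"
    by (subst inner_commute, simp add: w_def inner_glue[OF e], simp add: p1[unfolded w_def] inner_commute)
  finally show ?thesis using dw by (simp add: d_def)
qed

text \<open>Marginals of elliptical laws are elliptical: after completing the square, integrating out the
  other coordinates integrates \<open>h (u + q z)\<close> over \<open>z\<close>, with \<open>u\<close> the quadratic form of the kept block
  and \<open>q\<close> a positive definite form independent of the kept coordinates. The substitution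
  \<open>s = q z\<close> turns this into the one-dimensional integral that the last hypothesis asks \<open>k\<close> to be.
  That hypothesis includes \<open>u = 0\<close>, so the two densities agree everywhere and \<open>k\<close> inherits the
  measurability that a density must have.\<close>

theorem Ell_marginal:
  fixes e :: "'p::finite + 'q::finite \<Rightarrow> 'n::finite"
  assumes e: "bij e" and X: "Ell M X \<mu> S h"
    and h [measurable]: "h \<in> borel_measurable borel"
    and k_nonneg: "\<And>t. t > 0 \<Longrightarrow> 0 \<le> k t"
    and k: "\<And>u. u \<ge> 0 \<Longrightarrow>
      (\<integral>\<^sup>+s\<in>{0<..}. ennreal (s powr (real CARD('q) / 2 - 1)) * ennreal (h (u + s)) \<partial>lborel) = ennreal (k u)"
  shows "Ell M (\<lambda>\<omega>. part1 e (X \<omega>)) (part1 e \<mu>) (submat1 e S) k"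
proof -
  from X[unfolded Ell_def] obtain C where S: "pos_def_matrix S" and C: "C > 0" and dist: "distributed M lborel X
      (\<lambda>y. ennreal (C * det S powr (- 1 / 2) * h ((y - \<mu>) \<bullet> (matrix_inv S *v (y - \<mu>)))))"
    by (elim conjE exE)
  define K where "K = C * det S powr (- 1 / 2)"
  define f where "f y = ennreal (K * h ((y - \<mu>) \<bullet> (matrix_inv S *v (y - \<mu>))))" for y
  have f [measurable]: "f \<in> borel_measurable borel"
    and Xm [measurable]: "X \<in> M \<rightarrow>\<^sub>M borel"
    and Xd: "distr M lborel X = density lborel f"
    using dist[folded K_def, folded f_def] unfolding distributed_def by simp_all
  have detS: "det S \<noteq> 0" using pos_def_invertible[OF S] by (simp add: invertible_det_nz)
  then have K: "K > 0" using C by (simp add: K_def)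
  define S1 where "S1 = submat1 e S"
  have S1: "pos_def_matrix S1" unfolding S1_def by (rule pos_def_submat1[OF e S])
  then have detS1: "det S1 powr (- 1 / 2) > 0"
    using pos_def_invertible[OF S1] by (simp add: invertible_det_nz)
  define q where "q z = glue e 0 z \<bullet> (matrix_inv S *v glue e 0 z)" for z :: "real ^ 'q"
  have q_cont: "continuous_on UNIV q"
  proof -
    have "continuous_on UNIV (\<lambda>z. glue e 0 z)"
    proof -
      have "continuous_on UNIV (\<lambda>z :: real ^ 'q. (0 :: real ^ 'p, z))" by (intro continuous_intros)
      from continuous_on_compose2[OF continuous_on_glue[of e] this] show ?thesis by simp
    qed
    moreover from this have "continuous_on UNIV (\<lambda>z. matrix_inv S *v glue e 0 z)"
      by (rule continuous_on_compose2[OF matrix_vector_mult_linear_continuous_on[of UNIV]]) simp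
    ultimately show ?thesis unfolding q_def by (rule continuous_on_inner)
  qed
  have q_hom: "q (c *\<^sub>R z) = c\<^sup>2 * q z" for c z
    using glue_scaleR[of e c 0 z] by (simp add: q_def matrix_vector_mult_scaleR power2_eq_square)
  have q_pos: "0 < q z" if "z \<noteq> 0" for z
  proof -
    have "glue e 0 z \<noteq> 0"
      using part_glue(2)[OF e, of 0 z] that by (metis part_zero(2))
    then show ?thesis unfolding q_def by (rule pos_def_inverse_form(2)[OF S])
  qed
  obtain c where c: "c > 0" and push: "\<And>g :: real \<Rightarrow> ennreal. g \<in> borel_measurable borel \<Longrightarrow>
      (\<integral>\<^sup>+z. g (q z) \<partial>lborel) =
      ennreal c * (\<integral>\<^sup>+s\<in>{0<..}. ennreal (s powr (real CARD('q) / 2 - 1)) * g s \<partial>lborel)"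
    using nn_integral_degree_two_homogeneous[OF q_cont q_hom q_pos] by auto
  have q_meas [measurable]: "q \<in> borel_measurable borel"
    by (rule borel_measurable_continuous_onI[OF q_cont])
  define C1 where "C1 = K * c / det S1 powr (- 1 / 2)"
  have C1: "C1 > 0" using K c detS1 by (simp add: C1_def)
  define f1 where "f1 x = ennreal (C1 * det S1 powr (- 1 / 2) *
      k ((x - part1 e \<mu>) \<bullet> (matrix_inv S1 *v (x - part1 e \<mu>))))" for x
  \<comment> \<open>For fixed \<open>x\<close> the square is completed in \<open>y\<close>, the shift is absorbed by translation
    invariance, and what remains depends on \<open>y\<close> through the quadratic form \<open>q\<close> only.\<close>
  have inner: "(\<integral>\<^sup>+y. f (glue e x y) \<partial>lborel) = f1 x" for x
  proof -
    define u where "u = (x - part1 e \<mu>) \<bullet> (matrix_inv S1 *v (x - part1 e \<mu>))"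
    have u: "u \<ge> 0" using pos_def_inverse_form(2)[OF S1, of "x - part1 e \<mu>"] unfolding u_def
      by (cases "x - part1 e \<mu> = 0") auto
    define t where "t = part2 e \<mu> +
      part2 e (S *v glue e (matrix_inv (submat1 e S) *v (x - part1 e \<mu>)) 0)"
    have form: "f (glue e x y) = ennreal (K * h (u + q (y - t)))" for y
    proof -
      have "glue e x y - \<mu> = glue e (x - part1 e \<mu>) (y - part2 e \<mu>)"
        by (simp add: glue_diff glue_part[OF e])
      then show ?thesis
        unfolding f_def using inverse_form_complete_square[OF e S, of "x - part1 e \<mu>" "y - part2 e \<mu>"]
        by (simp add: u_def q_def t_def S1_def diff_diff_eq)
    qed
    have "(\<integral>\<^sup>+y. f (glue e x y) \<partial>lborel) =
        (\<integral>\<^sup>+y. ennreal (K * h (u + q (y - t))) \<partial>distr lborel borel ((+) t))"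
      unfolding form lborel_distr_plus ..
    also have "\<dots> = (\<integral>\<^sup>+z. ennreal (K * h (u + q z)) \<partial>lborel)"
      by (subst nn_integral_distr) auto
    also have "\<dots> = ennreal K * (\<integral>\<^sup>+z. ennreal (h (u + q z)) \<partial>lborel)"
      using K by (simp add: ennreal_mult' nn_integral_cmult)
    also have "(\<integral>\<^sup>+z. ennreal (h (u + q z)) \<partial>lborel) = ennreal c * ennreal (k u)"
      by (subst push[of "\<lambda>s. ennreal (h (u + s))"]) (auto simp: k[OF u])
    also have "ennreal K * (ennreal c * ennreal (k u)) = ennreal (K * c * k u)"
      using K c by (simp add: ennreal_mult' mult.assoc)
    also have "\<dots> = f1 x"
      using detS1 by (simp add: f1_def C1_def u_def)
    finally show ?thesis .
  qed
  have f1 [measurable]: "f1 \<in> borel_measurable borel"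
    using nn_integral_glue(1)[OF e f] by (simp add: inner)
  have p1 [measurable]: "part1 e \<in> borel \<rightarrow>\<^sub>M borel"
    by (rule borel_measurable_continuous_onI[OF continuous_on_part1])
  have "distr M lborel (\<lambda>\<omega>. part1 e (X \<omega>)) = density lborel f1"
  proof (rule measure_eqI)
    fix A assume "A \<in> sets (distr M lborel (\<lambda>\<omega>. part1 e (X \<omega>)))"
    then have A [measurable]: "A \<in> sets borel" by simp
    have "emeasure (distr M lborel (\<lambda>\<omega>. part1 e (X \<omega>))) A =
        emeasure (distr M lborel X) (part1 e -` A)"
      by (subst (1 2) emeasure_distr) (auto intro!: arg_cong2[where f = emeasure] measurable_sets_borel[OF p1])
    also have "\<dots> = (\<integral>\<^sup>+v. f v * indicator A (part1 e v) \<partial>lborel)"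
      unfolding Xd by (subst emeasure_density)
        (auto intro!: nn_integral_cong measurable_sets_borel[OF p1] split: split_indicator)
    also have "\<dots> = (\<integral>\<^sup>+x. \<integral>\<^sup>+y. f (glue e x y) * indicator A x \<partial>lborel \<partial>lborel)"
      by (subst nn_integral_glue(2)[OF e]) (auto simp: part_glue[OF e])
    also have "\<dots> = (\<integral>\<^sup>+x. f1 x * indicator A x \<partial>lborel)"
      by (intro nn_integral_cong) (auto simp: inner split: split_indicator)
    also have "\<dots> = emeasure (density lborel f1) A"
      by (subst emeasure_density) auto
    finally show "emeasure (distr M lborel (\<lambda>\<omega>. part1 e (X \<omega>))) A = emeasure (density lborel f1) A" .
  qed simp
  then have "distributed M lborel (\<lambda>\<omega>. part1 e (X \<omega>)) f1"
    unfolding distributed_def by auto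
  then show ?thesis
    unfolding Ell_def S1_def[symmetric] using S1 C1 k_nonneg unfolding f1_def
    by (intro conjI allI impI exI[of _ C1])
qed

section \<open>The marginal generator as an integral\<close>

lemma falling_factorial_div_fact:
  "falling_factorial (real n) j / fact j = real (n choose j)"
  by (simp add: falling_factorial_def binomial_gbinomial gbinomial_prod_rev atLeast0LessThan)

text \<open>The integrand of the Hurwitz-Lerch function in the variable \<open>s = t / b\<close>, which carries the
  parameters of the generator.\<close>

definition lerch_integrand :: "real \<Rightarrow> real \<Rightarrow> real \<Rightarrow> real \<Rightarrow> real \<Rightarrow> real \<Rightarrow> real" where
  "lerch_integrand a b r u \<sigma> s =
     s powr (\<sigma> - 1) * exp (- a * s) / (1 + exp (- b * (u + s))) powr (2 * r)"

text \<open>The denominator is at least 1, so a rescaled Gamma integrand dominates. Integrability lets the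
  Bochner integrals that define the marginal generator be read as nonnegative integrals; without it
  they could be the default value 0.\<close>

lemma set_integrable_lerch_integrand:
  assumes "a > 0" "r \<ge> 0" "\<sigma> > 0"
  shows "set_integrable lborel {0<..} (lerch_integrand a b r u \<sigma>)"
proof -
  have "(\<integral>\<^sup>+t. ennreal (indicator {0..} t * t powr (\<sigma> - 1) / exp t) \<partial>lborel) < \<infinity>"
    using Gamma_conv_nn_integral_real[OF assms(3)] by (metis ennreal_less_top infinity_ennreal_def)
  then have "integrable lborel (\<lambda>t. indicator {0..} t * t powr (\<sigma> - 1) / exp t)"
    by (intro integrableI_nonneg) auto
  then have "integrable lborel (\<lambda>t. indicator {0..} (0 + a * t) * (0 + a * t) powr (\<sigma> - 1) / exp (0 + a * t))"
    by (rule lborel_integrable_real_affine) (use assms in auto)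
  then have I: "integrable lborel (\<lambda>t. a powr (1 - \<sigma>) * (indicator {0..} (0 + a * t) * (0 + a * t) powr (\<sigma> - 1) / exp (0 + a * t)))"
    by (rule integrable_mult_right)
  show ?thesis unfolding set_integrable_def
  proof (rule Bochner_Integration.integrable_bound[OF I])
    show "(\<lambda>s. indicator {0<..} s *\<^sub>R lerch_integrand a b r u \<sigma> s) \<in> borel_measurable lborel"
      unfolding lerch_integrand_def by measurable
    show "AE s in lborel. norm (indicator {0<..} s *\<^sub>R lerch_integrand a b r u \<sigma> s) \<le>
      norm (a powr (1 - \<sigma>) * (indicator {0..} (0 + a * s) * (0 + a * s) powr (\<sigma> - 1) / exp (0 + a * s)))"
    proof (rule AE_I2)
      fix s
      show "norm (indicator {0<..} s *\<^sub>R lerch_integrand a b r u \<sigma> s) \<le>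
        norm (a powr (1 - \<sigma>) * (indicator {0..} (0 + a * s) * (0 + a * s) powr (\<sigma> - 1) / exp (0 + a * s)))"
      proof (cases "s > 0")
        case True
        have "1 \<le> (1 + exp (- b * (u + s))) powr (2 * r)"
          using assms by (intro ge_one_powr_ge_zero) auto
        then have "lerch_integrand a b r u \<sigma> s \<le> s powr (\<sigma> - 1) * exp (- a * s)"
          unfolding lerch_integrand_def
          using frac_le[OF _ order_refl zero_less_one, of "s powr (\<sigma> - 1) * exp (- a * s)"
              "(1 + exp (- b * (u + s))) powr (2 * r)"] by simp
        moreover have "a powr (1 - \<sigma>) * (a powr (\<sigma> - 1)) = 1"
          using assms by (simp add: powr_add[symmetric])
        then have "a powr (1 - \<sigma>) * (indicator {0..} (0 + a * s) * (0 + a * s) powr (\<sigma> - 1) / exp (0 + a * s))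
            = s powr (\<sigma> - 1) * exp (- a * s)"
          using True assms by (simp add: powr_mult exp_minus divide_inverse mult.assoc[symmetric])
        ultimately show ?thesis
          using True by (simp add: lerch_integrand_def)
      qed simp
    qed
  qed
qed

text \<open>Substituting \<open>t = b * s\<close>: the factor \<open>b powr \<sigma>\<close>, which comes from \<open>dt\<close> and
  \<open>t powr (\<sigma> - 1)\<close>, and the \<open>Gamma \<sigma>\<close> of the definition cancel against the coefficient.\<close>

lemma hurwitz_lerch_eq_lerch_integral:
  assumes b: "b > 0" and \<sigma>: "\<sigma> > 0"
  shows "Gamma \<sigma> / b powr \<sigma> * hurwitz_lerch (2 * r) (- exp (- b * u)) \<sigma> (a / b) =
    (LBINT s:{0<..}. lerch_integrand a b r u \<sigma> s)"
proof -
  let ?F = "\<lambda>t. indicator {0<..} t *\<^sub>R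
    (t powr (\<sigma> - 1) * exp (- (a / b) * t) / (1 - (- exp (- b * u)) * exp (- t)) powr (2 * r))"
  have "(LINT t|lborel. ?F t) = b * (LINT s|lborel. ?F (0 + b * s))"
    using lborel_integral_real_affine[of b ?F 0] b by simp
  also have "(\<lambda>s. ?F (0 + b * s)) =
      (\<lambda>s. b powr (\<sigma> - 1) * (indicator {0<..} s *\<^sub>R lerch_integrand a b r u \<sigma> s))"
    using b by (auto simp: fun_eq_iff lerch_integrand_def indicator_def powr_mult zero_less_mult_iff
        exp_add[symmetric] algebra_simps)
  also have "b * (LINT s|lborel. b powr (\<sigma> - 1) * (indicator {0<..} s *\<^sub>R lerch_integrand a b r u \<sigma> s))
      = b powr \<sigma> * (LBINT s:{0<..}. lerch_integrand a b r u \<sigma> s)"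
    using b by (simp add: set_lebesgue_integral_def powr_diff)
  finally show ?thesis
    using b Gamma_real_pos[OF \<sigma>] by (simp add: hurwitz_lerch_def set_lebesgue_integral_def)
qed

lemma marginal_generator_eq_sum:
  assumes "b > 0" and N: "1 \<le> N" and d: "n - m > 0"
  shows "marginal_generator N a b r n m u = (\<Sum>j = 0..N - 1. real (N - 1 choose j) * u ^ (N - 1 - j) *
    exp (- a * u) * (LBINT s:{0<..}. lerch_integrand a b r u (real (n - m) / 2 + real j) s))"
  unfolding marginal_generator_def
proof (rule sum.cong)
  fix j
  have "real N - 1 = real (N - 1)" using N by simp
  then have B: "falling_factorial (real N - 1) j / fact j = real (N - 1 choose j)"
    by (simp only: falling_factorial_div_fact)
  have "real (n - m) / 2 + real j > 0" using d by (intro add_pos_nonneg) auto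
  from hurwitz_lerch_eq_lerch_integral[OF assms(1) this, of r u a, symmetric]
  show "falling_factorial (real N - 1) j / fact j *
        (Gamma (real (n - m) / 2 + real j) / b powr (real (n - m) / 2 + real j)) *
        u ^ (N - 1 - j) * exp (- a * u) *
        hurwitz_lerch (2 * r) (- exp (- b * u)) (real (n - m) / 2 + real j) (a / b) =
    real (N - 1 choose j) * u ^ (N - 1 - j) *
    exp (- a * u) * (LBINT s:{0<..}. lerch_integrand a b r u (real (n - m) / 2 + real j) s)"
    unfolding B by (simp only: mult_ac)
qed simp

lemma lerch_integral_nonneg: "0 \<le> (LBINT s:{0<..}. lerch_integrand a b r u \<sigma> s)"
  unfolding set_lebesgue_integral_def
  by (intro Bochner_Integration.integral_nonneg) (auto simp: lerch_integrand_def indicator_def)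

lemma marginal_generator_nonneg:
  assumes "b > 0" "1 \<le> N" "n - m > 0" "u \<ge> 0"
  shows "0 \<le> marginal_generator N a b r n m u"
  unfolding marginal_generator_eq_sum[OF assms(1-3)]
  using assms(4) by (intro sum_nonneg mult_nonneg_nonneg lerch_integral_nonneg) auto

text \<open>The binomial expansion of \<open>(u + s) ^ (N - 1)\<close> under the integral sign: the powers of \<open>u\<close> and
  the factor \<open>exp (- a * u)\<close> leave the integral, and each power \<open>s ^ j\<close> raises the second parameter of
  the Lerch integrand by \<open>j\<close>.\<close>

lemma nn_integral_gl_generator:
  assumes a: "a > 0" and b: "b > 0" and r: "r \<ge> 0" and N: "1 \<le> N" and d: "n - m > 0" and u: "u \<ge> 0"
  shows "(\<integral>\<^sup>+s\<in>{0<..}. ennreal (s powr (real (n - m) / 2 - 1)) *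
      ennreal (gl_generator (real N) a b r (u + s)) \<partial>lborel) = ennreal (marginal_generator N a b r n m u)"
proof -
  define d2 where "d2 = real (n - m) / 2"
  have d2: "d2 > 0" using d by (simp add: d2_def)
  define cf where "cf j = real (N - 1 choose j) * u ^ (N - 1 - j) * exp (- a * u)" for j
  have cf: "cf j \<ge> 0" for j using u by (simp add: cf_def)
  define G where "G s = (\<Sum>j = 0..N - 1. cf j * (indicator {0<..} s *\<^sub>R lerch_integrand a b r u (d2 + real j) s))" for s
  \<comment> \<open>Restricting to \<open>s > 0\<close> keeps \<open>u + s\<close> positive, where \<open>powr\<close> and natural powers agree;
    at \<open>u = s = 0\<close> and \<open>N = 1\<close> they do not.\<close>
  have expand: "s powr (d2 - 1) * gl_generator (real N) a b r (u + s) * indicator {0<..} s = G s" for s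
  proof (cases "s > 0")
    case True
    have "(u + s) powr (real N - 1) = (u + s) ^ (N - 1)"
      using True u N by (simp add: powr_realpow[symmetric] of_nat_diff)
    also have "\<dots> = (s + u) ^ (N - 1)" by (simp add: add.commute)
    also have "\<dots> = (\<Sum>j = 0..N - 1. real (N - 1 choose j) * s ^ j * u ^ (N - 1 - j))"
      by (simp add: binomial_ring atLeast0AtMost)
    finally have "s powr (d2 - 1) * gl_generator (real N) a b r (u + s) =
        (\<Sum>j = 0..N - 1. s powr (d2 - 1) * (real (N - 1 choose j) * s ^ j * u ^ (N - 1 - j)) *
          exp (- a * (u + s)) / (1 + exp (- b * (u + s))) powr (2 * r))"
      by (simp add: gl_generator_def sum_distrib_left sum_distrib_right sum_divide_distrib mult.assoc)
    also have "\<dots> = (\<Sum>j = 0..N - 1. cf j * lerch_integrand a b r u (d2 + real j) s)"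
    proof (rule sum.cong)
      fix j
      have "s powr (d2 + real j - 1) = s powr (d2 - 1) * s ^ j"
        using True by (simp add: powr_realpow[symmetric] powr_add[symmetric] algebra_simps)
      moreover have "exp (- a * (u + s)) = exp (- a * u) * exp (- a * s)"
        by (simp add: exp_add[symmetric] algebra_simps)
      ultimately show "s powr (d2 - 1) * (real (N - 1 choose j) * s ^ j * u ^ (N - 1 - j)) *
          exp (- a * (u + s)) / (1 + exp (- b * (u + s))) powr (2 * r) =
          cf j * lerch_integrand a b r u (d2 + real j) s"
        by (simp only: cf_def lerch_integrand_def) (simp only: times_divide_eq_right mult_ac)
    qed simp
    finally show ?thesis using True by (simp add: G_def)
  qed (simp add: G_def)
  have int: "integrable lborel (\<lambda>s. cf j * (indicator {0<..} s *\<^sub>R lerch_integrand a b r u (d2 + real j) s))" for j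
    using set_integrable_lerch_integrand[OF a r, of "d2 + real j" b u] d2
    by (intro integrable_mult_right) (simp add: set_integrable_def)
  have "(\<integral>\<^sup>+s\<in>{0<..}. ennreal (s powr (d2 - 1)) * ennreal (gl_generator (real N) a b r (u + s)) \<partial>lborel)
      = (\<integral>\<^sup>+s. ennreal (G s) \<partial>lborel)"
    by (intro nn_integral_cong)
      (auto simp: expand[symmetric] ennreal_mult'[symmetric] split: split_indicator)
  also have "\<dots> = ennreal (LINT s|lborel. G s)"
  proof (rule nn_integral_eq_integral)
    show "integrable lborel G" unfolding G_def using int by (intro Bochner_Integration.integrable_sum)
    show "AE s in lborel. 0 \<le> G s"
      unfolding G_def by (intro AE_I2 sum_nonneg mult_nonneg_nonneg cf) (auto simp: lerch_integrand_def indicator_def)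
  qed
  also have "(LINT s|lborel. G s) =
      (\<Sum>j = 0..N - 1. cf j * (LBINT s:{0<..}. lerch_integrand a b r u (d2 + real j) s))"
    unfolding G_def using int by (subst Bochner_Integration.integral_sum) (auto simp: set_lebesgue_integral_def)
  also have "\<dots> = marginal_generator N a b r n m u"
    unfolding marginal_generator_eq_sum[OF b N d] by (simp add: cf_def d2_def)
  finally show ?thesis by (simp add: d2_def)
qed

section \<open>Marginals of the generalized elliptical logistic distribution\<close>

theorem corollary7p1:
  fixes M :: "'w measure"
    and X :: "'w \<Rightarrow> real ^ ('m::finite + 'k::finite)"
    and \<mu> :: "real ^ ('m + 'k)"
    and \<Sigma> :: "real ^ ('m + 'k) ^ ('m + 'k)"
    and m n N :: nat
    and a b r :: real
  assumes "prob_space M"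
    and "1 \<le> m" and "m < n"
    and "CARD('m) = m" and "CARD('k) = n - m"
    and "1 \<le> N" and "2 * N + n > 2"
    and "a > 0" and "b > 0" and "r \<ge> 0"
    and "GL M X \<mu> \<Sigma> (real N) a b r"
  shows "Ell M (\<lambda>\<omega>. vec_block1 (X \<omega>)) (vec_block1 \<mu>) (mat_block11 \<Sigma>)
           (marginal_generator N a b r n m) \<and>
         Ell M (\<lambda>\<omega>. vec_block2 (X \<omega>)) (vec_block2 \<mu>) (mat_block22 \<Sigma>)
           (marginal_generator N a b r n (n - m))"
proof
  have b: "b > 0" and d1: "n - m > 0" and d2: "n - (n - m) > 0" using assms by auto
  have cards: "CARD('k) = n - m" "CARD('m) = n - (n - m)" using assms by auto
  have X: "Ell M X \<mu> \<Sigma> (gl_generator (real N) a b r)" using assms by (simp add: GL_def)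
  have g: "gl_generator (real N) a b r \<in> borel_measurable borel"
    unfolding gl_generator_def by measurable
  note gen = nn_integral_gl_generator[OF \<open>a > 0\<close> b \<open>r \<ge> 0\<close> \<open>1 \<le> N\<close>]
  have "Ell M (\<lambda>\<omega>. part1 (id :: 'm + 'k \<Rightarrow> _) (X \<omega>)) (part1 id \<mu>) (submat1 id \<Sigma>)
      (marginal_generator N a b r n m)"
    using gen[OF d1] marginal_generator_nonneg[OF b \<open>1 \<le> N\<close> d1]
    by (intro Ell_marginal[OF _ X g]) (auto simp: cards(1))
  then show "Ell M (\<lambda>\<omega>. vec_block1 (X \<omega>)) (vec_block1 \<mu>) (mat_block11 \<Sigma>)
      (marginal_generator N a b r n m)"
    by (simp add: part1_def submat1_def vec_block1_def mat_block11_def)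
  define e :: "'k + 'm \<Rightarrow> 'm + 'k" where "e = case_sum Inr Inl"
  have e: "bij e"
    by (rule o_bij[of "case_sum Inr Inl"]) (auto simp: e_def fun_eq_iff split: sum.splits)
  have "Ell M (\<lambda>\<omega>. part1 e (X \<omega>)) (part1 e \<mu>) (submat1 e \<Sigma>) (marginal_generator N a b r n (n - m))"
    using gen[OF d2] marginal_generator_nonneg[OF b \<open>1 \<le> N\<close> d2]
    by (intro Ell_marginal[OF e X g]) (auto simp: cards(2))
  then show "Ell M (\<lambda>\<omega>. vec_block2 (X \<omega>)) (vec_block2 \<mu>) (mat_block22 \<Sigma>)
      (marginal_generator N a b r n (n - m))"
    by (simp add: e_def part1_def submat1_def vec_block2_def mat_block22_def)
qed

end
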